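(* There exist a protected decomposition (protected and adaptive trigger and response components over a finite set of atomic propositions, together with a designer-fixed threshold $\lambda_{\mathrm{core}}\in[0,1]$), a probability law of the timed stream, two regimes $R_0$ and $R_1$, and a candidate specification $\psi^\star$ with that decomposition, such that $$p_{R_0}(\psi^\star)=p_{R_1}(\psi^\star),\qquad p_{R_0}^{\mathrm{core}}(\psi^\star)=0.99,\qquad p_{R_1}^{\mathrm{core}}(\psi^\star)=0.$$ Moreover, if $R_1$ governs an infinite post-selection certification sequence (the candidate $\psi^\star$ is selected at a finite index $n^\star$, and the origins $k>n^\star$ of its triggered, completed obligations are infinite in number and all lie in $R_1$), then aggregate-only certification eventually certifies $\psi^\star$ almost surely, whereas the joint aggregate and core-conditional criterion never certifies it.
   Context: Timed streams. Let $\mathcal{AP}$ be a finite set of atomic propositions. An infinite timed stream is a sequence $\mathbf e=e_0e_1e_2\cdots$ with $e_n=(t_n,\nu_n)$, $t_n\in\mathbb R_{\ge0}$, $\nu_n\subseteq\mathcal{AP}$, $t_n\le t_{n+1}$ for all $n$, and $\lim_{n\to\infty}t_n=\infty$. In this statement $\mathbf e$ is a random timed stream on a probability space, with law denoted $\Pr$. Formulas. $\Phi$ is generated by $\varphi::=p\mid\top\mid\bot\mid\neg\varphi\mid\varphi\land\varphi\mid\varphi\lor\varphi\mid\Box_{[a,b]}\varphi\mid\Diamond_{[a,b]}\varphi$ with $p\in\mathcal{AP}$, $0\le a\le b<\infty$. Satisfaction: $\mathbf e,n\models p$ iff $p\in\nu_n$; $\top$ always, $\bot$ never; Boolean connectives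 as usual; $\mathbf e,n\models\Box_{[a,b]}\varphi$ iff for all $m\ge n$ with $t_m-t_n\in[a,b]$, $\mathbf e,m\models\varphi$; $\mathbf e,n\models\Diamond_{[a,b]}\varphi$ iff there is such an $m$ with $\mathbf e,m\models\varphi$. Horizon: $\operatorname{hzn}(p)=\operatorname{hzn}(\top)=\operatorname{hzn}(\bot)=0$, $\operatorname{hzn}(\neg\varphi)=\operatorname{hzn}(\varphi)$, $\operatorname{hzn}$ of a conjunction or disjunction is the maximum, $\operatorname{hzn}(\Box_{[a,b]}\varphi)=\operatorname{hzn}(\Diamond_{[a,b]}\varphi)=b+\operatorname{hzn}(\varphi)$. Specifications. A specification is a tuple $\psi=(\varphi_1^{\mathrm{core}},\varphi_1^{\mathrm{adapt}},\varphi_2^{\mathrm{core}},\varphi_2^{\mathrm{adapt}},\lambda,a,b)$ with formulas in $\Phi$, $\lambda\in[0,1]$, $0\le a\le b<\infty$, $(\lambda,a,b)$ in a designer-fixed admissible envelope. The "core" formulas are protected, the "adapt" ones adaptive. $\operatorname{trig}(\psi)=\varphi_1^{\mathrm{core}}\lor\varphi_1^{\mathrm{adapt}}$, $\operatorname{resp}(\psi)=\varphi_2^{\mathrm{core}}\land\varphi_2^{\mathrm{adapt}}$, $H(\psi)=\max\{\operatorname{hzn}(\operatorname{trig}(\psi)),b+\operatorname{hzn}(\operatorname{resp}(\psi))\}$, and $X_k^{\psi}=\mathbf 1[\exists m\ge k: t_m-t_k\in[a,b]\land\mathbf e,m\models\operatorname{resp}(\psi)]$. Regimes. Regimes form an ordered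 sequence $R_0,R_1,\ldots$ of nonempty contiguous sets of event indices; whenever $R_{r+1}$ exists, $R_r$ is finite and $\min R_{r+1}=\max R_r+1$. For $n\in R_r$ let $E_{n,r}^{\psi}=\{\exists m\in R_r: m\ge n,\ t_m>t_n+H(\psi)\}$. An index $n\in R_r$ is eligible if $\Pr(\{\mathbf e,n\models\operatorname{trig}(\psi)\}\cap E_{n,r}^\psi)>0$. Regime-level stability: $\Pr(X_n^\psi=1\mid \mathbf e,n\models\operatorname{trig}(\psi),E_{n,r}^\psi)$ has the same value for all eligible $n\in R_r$ (with at least one eligible $n$); this value is $p_{R_r}(\psi)$. Within-group stability: for eligible $k$ the two groups $\mathbf e,k\models\varphi_1^{\mathrm{core}}$ (protected) and $\mathbf e,k\models\varphi_1^{\mathrm{adapt}}\land\neg\varphi_1^{\mathrm{core}}$ (adaptive-only) have positive probability jointly with $E_{k,r}^\psi$, and the quantities $\Pr(\mathbf e,k\models\varphi_1^{\mathrm{core}}\mid\mathbf e,k\models\operatorname{trig}(\psi),E_{k,r}^\psi)$, $\Pr(X_k^\psi=1\mid\mathbf e,k\models\varphi_1^{\mathrm{core}},E_{k,r}^\psi)$ and $\Pr(X_k^\psi=1\mid\mathbf e,k\models\varphi_1^{\mathrm{adapt}}\land\neg\varphi_1^{\mathrm{core}},E_{k,r}^\psi)$ do not depend on the eligible $k\in R_r$. The second of these is $p_{R_r}^{\mathrm{core}}(\psi)$. The statement asserts in particular that $p_{R_r}(\psi^\star)$ and $p_{R_r}^{\mathrm{core}}(\psi^\star)$, $r=0,1$,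 are well defined in this sense. Certification. Let $\psi^\star$ have threshold $\lambda^\star$, horizon $H^\star=H(\psi^\star)$ and protected trigger $\varphi_1^{\mathrm{core}}\neq\bot$, and be selected at event index $n^\star$. For $m>n^\star$ let $K_m^{(\mathrm{all})}=\{k>n^\star:\mathbf e,k\models\operatorname{trig}(\psi^\star),\ t_m>t_k+H^\star\}$ and $K_m^{(\mathrm{core})}=\{k\in K_m^{(\mathrm{all})}:\mathbf e,k\models\varphi_1^{\mathrm{core}}\}$. For $g\in\{\mathrm{all},\mathrm{core}\}$ let $N_m^{(g)}=|K_m^{(g)}|$ and, when $N_m^{(g)}>0$, $\widehat p_m^{(g)}=\frac1{N_m^{(g)}}\sum_{k\in K_m^{(g)}}X_k^{\psi^\star}$. With error allocations $\delta^{(\mathrm{all})},\delta^{(\mathrm{core})}>0$ (of sum less than $1$) fixed at selection time, put $$L_m^{(g)}=\max\Bigl\{0,\ \widehat p_m^{(g)}-\sqrt{\tfrac{\log(1/\delta_q^{(g)})}{2q}}\Bigr\},\quad q=N_m^{(g)}>0,\quad \delta_q^{(g)}=\tfrac{6\delta^{(g)}}{\pi^2q^2},$$ and $L_m^{(g)}=0$ if $N_m^{(g)}=0$. The joint criterion certifies $\psi^\star$ at $m>n^\star$ if $N_m^{(\mathrm{all})}>0$, $L_m^{(\mathrm{all})}\ge\lambda^\star$, $N_m^{(\mathrm{core})}>0$ and $L_m^{(\mathrm{core})}\ge\lambda_{\mathrm{core}}$. Aggregate-only certification certifies $\psi^\star$ at $m$ if $N_m^{(\mathrm{all})}>0$ and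 $L_m^{(\mathrm{all})}\ge\lambda^\star$. "Eventually certifies" means at some $m>n^\star$; "never certifies" means at no $m>n^\star$. *)

theory Defs
  imports "HOL-Probability.Probability" "HOL-Library.Extended_Nat"
begin

type_synonym 'p tstream = "nat \<Rightarrow> real \<times> 'p set"

abbreviation time :: "'p tstream \<Rightarrow> nat \<Rightarrow> real" where
  "time e n \<equiv> fst (e n)"

abbreviation label :: "'p tstream \<Rightarrow> nat \<Rightarrow> 'p set" where
  "label e n \<equiv> snd (e n)"

definition timed_stream :: "'p set \<Rightarrow> 'p tstream \<Rightarrow> bool" where
  "timed_stream AP e \<longleftrightarrow>
     (\<forall>n. 0 \<le> time e n \<and> label e n \<subseteq> AP \<and> time e n \<le> time e (Suc n)) \<and>
     filterlim (time e) at_top sequentially"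

datatype 'p fml =
    Atom 'p
  | Top
  | Bot
  | Neg "'p fml"
  | Conj "'p fml" "'p fml"
  | Disj "'p fml" "'p fml"
  | Box real real "'p fml"
  | Dia real real "'p fml"

primrec wf_fml :: "'p set \<Rightarrow> 'p fml \<Rightarrow> bool" where
  "wf_fml AP (Atom p) \<longleftrightarrow> p \<in> AP"
| "wf_fml AP Top \<longleftrightarrow> True"
| "wf_fml AP Bot \<longleftrightarrow> True"
| "wf_fml AP (Neg \<phi>) \<longleftrightarrow> wf_fml AP \<phi>"
| "wf_fml AP (Conj \<phi> \<theta>) \<longleftrightarrow> wf_fml AP \<phi> \<and> wf_fml AP \<theta>"
| "wf_fml AP (Disj \<phi> \<theta>) \<longleftrightarrow> wf_fml AP \<phi> \<and> wf_fml AP \<theta>"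
| "wf_fml AP (Box a b \<phi>) \<longleftrightarrow> 0 \<le> a \<and> a \<le> b \<and> wf_fml AP \<phi>"
| "wf_fml AP (Dia a b \<phi>) \<longleftrightarrow> 0 \<le> a \<and> a \<le> b \<and> wf_fml AP \<phi>"

primrec sat :: "'p tstream \<Rightarrow> 'p fml \<Rightarrow> nat \<Rightarrow> bool" where
  "sat e (Atom p) n \<longleftrightarrow> p \<in> label e n"
| "sat e Top n \<longleftrightarrow> True"
| "sat e Bot n \<longleftrightarrow> False"
| "sat e (Neg \<phi>) n \<longleftrightarrow> \<not> sat e \<phi> n"
| "sat e (Conj \<phi> \<theta>) n \<longleftrightarrow> sat e \<phi> n \<and> sat e \<theta> n"
| "sat e (Disj \<phi> \<theta>) n \<longleftrightarrow> sat e \<phi> n \<or> sat e \<theta> n"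
| "sat e (Box a b \<phi>) n \<longleftrightarrow> (\<forall>m\<ge>n. time e m - time e n \<in> {a..b} \<longrightarrow> sat e \<phi> m)"
| "sat e (Dia a b \<phi>) n \<longleftrightarrow> (\<exists>m\<ge>n. time e m - time e n \<in> {a..b} \<and> sat e \<phi> m)"

primrec hzn :: "'p fml \<Rightarrow> real" where
  "hzn (Atom p) = 0"
| "hzn Top = 0"
| "hzn Bot = 0"
| "hzn (Neg \<phi>) = hzn \<phi>"
| "hzn (Conj \<phi> \<theta>) = max (hzn \<phi>) (hzn \<theta>)"
| "hzn (Disj \<phi> \<theta>) = max (hzn \<phi>) (hzn \<theta>)"
| "hzn (Box a b \<phi>) = b + hzn \<phi>"
| "hzn (Dia a b \<phi>) = b + hzn \<phi>"

record 'p tspec =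
  trig_core  :: "'p fml"
  trig_adapt :: "'p fml"
  resp_core  :: "'p fml"
  resp_adapt :: "'p fml"
  threshold  :: real
  win_lo     :: real
  win_hi     :: real

definition trig :: "'p tspec \<Rightarrow> 'p fml" where
  "trig \<psi> = Disj (trig_core \<psi>) (trig_adapt \<psi>)"

definition resp :: "'p tspec \<Rightarrow> 'p fml" where
  "resp \<psi> = Conj (resp_core \<psi>) (resp_adapt \<psi>)"

definition horizon :: "'p tspec \<Rightarrow> real" where
  "horizon \<psi> = max (hzn (trig \<psi>)) (win_hi \<psi> + hzn (resp \<psi>))"

text \<open>The set \<open>Env\<close> is the admissible envelope for (threshold, lower window end, upper window end).\<close>

definition valid_spec :: "'p set \<Rightarrow> (real \<times> real \<times> real) set \<Rightarrow> 'p tspec \<Rightarrow> bool" where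
  "valid_spec AP Env \<psi> \<longleftrightarrow>
     wf_fml AP (trig_core \<psi>) \<and> wf_fml AP (trig_adapt \<psi>) \<and>
     wf_fml AP (resp_core \<psi>) \<and> wf_fml AP (resp_adapt \<psi>) \<and>
     0 \<le> threshold \<psi> \<and> threshold \<psi> \<le> 1 \<and>
     0 \<le> win_lo \<psi> \<and> win_lo \<psi> \<le> win_hi \<psi> \<and>
     (threshold \<psi>, win_lo \<psi>, win_hi \<psi>) \<in> Env"

definition responded :: "'p tspec \<Rightarrow> 'p tstream \<Rightarrow> nat \<Rightarrow> bool" where
  "responded \<psi> e k \<longleftrightarrow>
     (\<exists>m\<ge>k. time e m - time e k \<in> {win_lo \<psi>..win_hi \<psi>} \<and> sat e (resp \<psi>) m)"

abbreviation resp_ind :: "'p tspec \<Rightarrow> 'p tstream \<Rightarrow> nat \<Rightarrow> real" where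
  "resp_ind \<psi> e k \<equiv> of_bool (responded \<psi> e k)"

definition random_timed_stream :: "'p set \<Rightarrow> 'w measure \<Rightarrow> ('w \<Rightarrow> 'p tstream) \<Rightarrow> bool" where
  "random_timed_stream AP M S \<longleftrightarrow>
     prob_space M \<and>
     S \<in> M \<rightarrow>\<^sub>M (\<Pi>\<^sub>M n\<in>UNIV. borel \<Otimes>\<^sub>M count_space (Pow AP)) \<and>
     (\<forall>\<omega>\<in>space M. timed_stream AP (S \<omega>))"

text \<open>
  A (finite or infinite) sequence of regimes is given by its length \<open>N\<close> and the sets
  \<open>Rs r\<close> for \<open>r < N\<close>; the values of \<open>Rs\<close> at other arguments are irrelevant.  The minimum of a
  regime is written as \<^term>\<open>Inf\<close>, because the last regime may be infinite.
\<close>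

definition regime_sequence :: "enat \<Rightarrow> (nat \<Rightarrow> nat set) \<Rightarrow> bool" where
  "regime_sequence N Rs \<longleftrightarrow>
     (\<forall>r. enat r < N \<longrightarrow> Rs r \<noteq> {} \<and> (\<forall>i\<in>Rs r. \<forall>j\<in>Rs r. {i..j} \<subseteq> Rs r)) \<and>
     (\<forall>r. enat (Suc r) < N \<longrightarrow> finite (Rs r) \<and> Inf (Rs (Suc r)) = Max (Rs r) + 1)"

definition completes_in :: "nat set \<Rightarrow> 'p tspec \<Rightarrow> 'p tstream \<Rightarrow> nat \<Rightarrow> bool" where
  "completes_in R \<psi> e n \<longleftrightarrow> (\<exists>m\<in>R. n \<le> m \<and> time e n + horizon \<psi> < time e m)"

definition eligible ::
    "'w measure \<Rightarrow> ('w \<Rightarrow> 'p tstream) \<Rightarrow> nat set \<Rightarrow> 'p tspec \<Rightarrow> nat set" where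
  "eligible M S R \<psi> =
     {n\<in>R. 0 < \<P>(\<omega> in M. sat (S \<omega>) (trig \<psi>) n \<and> completes_in R \<psi> (S \<omega>) n)}"

definition resp_prob ::
    "'w measure \<Rightarrow> ('w \<Rightarrow> 'p tstream) \<Rightarrow> nat set \<Rightarrow> 'p tspec \<Rightarrow> nat \<Rightarrow> real" where
  "resp_prob M S R \<psi> n =
     \<P>(\<omega> in M. responded \<psi> (S \<omega>) n \<bar> sat (S \<omega>) (trig \<psi>) n \<and> completes_in R \<psi> (S \<omega>) n)"

definition core_share ::
    "'w measure \<Rightarrow> ('w \<Rightarrow> 'p tstream) \<Rightarrow> nat set \<Rightarrow> 'p tspec \<Rightarrow> nat \<Rightarrow> real" where
  "core_share M S R \<psi> k =
     \<P>(\<omega> in M. sat (S \<omega>) (trig_core \<psi>) k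
        \<bar> sat (S \<omega>) (trig \<psi>) k \<and> completes_in R \<psi> (S \<omega>) k)"

definition core_resp_prob ::
    "'w measure \<Rightarrow> ('w \<Rightarrow> 'p tstream) \<Rightarrow> nat set \<Rightarrow> 'p tspec \<Rightarrow> nat \<Rightarrow> real" where
  "core_resp_prob M S R \<psi> k =
     \<P>(\<omega> in M. responded \<psi> (S \<omega>) k
        \<bar> sat (S \<omega>) (trig_core \<psi>) k \<and> completes_in R \<psi> (S \<omega>) k)"

definition adapt_only :: "'p tspec \<Rightarrow> 'p fml" where
  "adapt_only \<psi> = Conj (trig_adapt \<psi>) (Neg (trig_core \<psi>))"

definition adapt_resp_prob ::
    "'w measure \<Rightarrow> ('w \<Rightarrow> 'p tstream) \<Rightarrow> nat set \<Rightarrow> 'p tspec \<Rightarrow> nat \<Rightarrow> real" where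
  "adapt_resp_prob M S R \<psi> k =
     \<P>(\<omega> in M. responded \<psi> (S \<omega>) k
        \<bar> sat (S \<omega>) (adapt_only \<psi>) k \<and> completes_in R \<psi> (S \<omega>) k)"

definition regime_stable ::
    "'w measure \<Rightarrow> ('w \<Rightarrow> 'p tstream) \<Rightarrow> nat set \<Rightarrow> 'p tspec \<Rightarrow> bool" where
  "regime_stable M S R \<psi> \<longleftrightarrow>
     eligible M S R \<psi> \<noteq> {} \<and>
     (\<exists>v. \<forall>n\<in>eligible M S R \<psi>. resp_prob M S R \<psi> n = v)"

definition within_group_stable ::
    "'w measure \<Rightarrow> ('w \<Rightarrow> 'p tstream) \<Rightarrow> nat set \<Rightarrow> 'p tspec \<Rightarrow> bool" where
  "within_group_stable M S R \<psi> \<longleftrightarrow>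
     (\<forall>k\<in>eligible M S R \<psi>.
        0 < \<P>(\<omega> in M. sat (S \<omega>) (trig_core \<psi>) k \<and> completes_in R \<psi> (S \<omega>) k) \<and>
        0 < \<P>(\<omega> in M. sat (S \<omega>) (adapt_only \<psi>) k \<and> completes_in R \<psi> (S \<omega>) k)) \<and>
     (\<exists>v. \<forall>k\<in>eligible M S R \<psi>. core_share M S R \<psi> k = v) \<and>
     (\<exists>v. \<forall>k\<in>eligible M S R \<psi>. core_resp_prob M S R \<psi> k = v) \<and>
     (\<exists>v. \<forall>k\<in>eligible M S R \<psi>. adapt_resp_prob M S R \<psi> k = v)"

text \<open>
  The following two values are meaningful only under \<^const>\<open>regime_stable\<close> and (for the second)
  \<^const>\<open>within_group_stable\<close>, which make the described value unique and existent.
\<close>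

definition p_regime ::
    "'w measure \<Rightarrow> ('w \<Rightarrow> 'p tstream) \<Rightarrow> nat set \<Rightarrow> 'p tspec \<Rightarrow> real" where
  "p_regime M S R \<psi> = (THE v. \<forall>n\<in>eligible M S R \<psi>. resp_prob M S R \<psi> n = v)"

definition p_core_regime ::
    "'w measure \<Rightarrow> ('w \<Rightarrow> 'p tstream) \<Rightarrow> nat set \<Rightarrow> 'p tspec \<Rightarrow> real" where
  "p_core_regime M S R \<psi> = (THE v. \<forall>k\<in>eligible M S R \<psi>. core_resp_prob M S R \<psi> k = v)"

text \<open>Since the times of a timed stream diverge, the sets \<open>K_all\<close> and \<open>K_core\<close> are finite for it.\<close>

definition K_all :: "'p tspec \<Rightarrow> 'p tstream \<Rightarrow> nat \<Rightarrow> nat \<Rightarrow> nat set" where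
  "K_all \<psi> e nsel m =
     {k. nsel < k \<and> sat e (trig \<psi>) k \<and> time e k + horizon \<psi> < time e m}"

definition K_core :: "'p tspec \<Rightarrow> 'p tstream \<Rightarrow> nat \<Rightarrow> nat \<Rightarrow> nat set" where
  "K_core \<psi> e nsel m = {k \<in> K_all \<psi> e nsel m. sat e (trig_core \<psi>) k}"

definition emp_mean :: "'p tspec \<Rightarrow> 'p tstream \<Rightarrow> nat set \<Rightarrow> real" where
  "emp_mean \<psi> e K = (\<Sum>k\<in>K. resp_ind \<psi> e k) / real (card K)"

definition alloc :: "real \<Rightarrow> nat \<Rightarrow> real" where
  "alloc \<delta> q = 6 * \<delta> / (pi\<^sup>2 * (real q)\<^sup>2)"

definition lower_bound :: "real \<Rightarrow> 'p tspec \<Rightarrow> 'p tstream \<Rightarrow> nat set \<Rightarrow> real" where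
  "lower_bound \<delta> \<psi> e K =
     (if card K = 0 then 0
      else max 0 (emp_mean \<psi> e K - sqrt (ln (1 / alloc \<delta> (card K)) / (2 * real (card K)))))"

definition aggregate_certifies ::
    "real \<Rightarrow> 'p tspec \<Rightarrow> 'p tstream \<Rightarrow> nat \<Rightarrow> nat \<Rightarrow> bool" where
  "aggregate_certifies \<delta>all \<psi> e nsel m \<longleftrightarrow>
     card (K_all \<psi> e nsel m) > 0 \<and>
     lower_bound \<delta>all \<psi> e (K_all \<psi> e nsel m) \<ge> threshold \<psi>"

definition joint_certifies ::
    "real \<Rightarrow> real \<Rightarrow> real \<Rightarrow> 'p tspec \<Rightarrow> 'p tstream \<Rightarrow> nat \<Rightarrow> nat \<Rightarrow> bool" where
  "joint_certifies \<delta>all \<delta>core core_thr \<psi> e nsel m \<longleftrightarrow>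
     card (K_all \<psi> e nsel m) > 0 \<and>
     lower_bound \<delta>all \<psi> e (K_all \<psi> e nsel m) \<ge> threshold \<psi> \<and>
     card (K_core \<psi> e nsel m) > 0 \<and>
     lower_bound \<delta>core \<psi> e (K_core \<psi> e nsel m) \<ge> core_thr"

definition valid_allocs :: "real \<Rightarrow> real \<Rightarrow> bool" where
  "valid_allocs \<delta>all \<delta>core \<longleftrightarrow> 0 < \<delta>all \<and> 0 < \<delta>core \<and> \<delta>all + \<delta>core < 1"

definition completed_origins :: "'p tspec \<Rightarrow> 'p tstream \<Rightarrow> nat \<Rightarrow> nat set" where
  "completed_origins \<psi> e nsel = (\<Union>m\<in>{nsel<..}. K_all \<psi> e nsel m)"

definition governs :: "nat set \<Rightarrow> 'p tspec \<Rightarrow> 'p tstream \<Rightarrow> nat \<Rightarrow> bool" where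
  "governs R \<psi> e nsel \<longleftrightarrow>
     infinite (completed_origins \<psi> e nsel) \<and> completed_origins \<psi> e nsel \<subseteq> R"

end

theory Submission
  imports Defs "HOL-Real_Asymp.Real_Asymp"
begin

text \<open>
  A single fair bit decides whether the protected origins are the even or the odd indices, so each
  index is protected with probability one half, while along every path the two groups alternate.  At
  index 0 a protected origin is answered with probability 99/100 and an adaptive-only one with
  probability 1/100; at all later indices exactly the adaptive-only origins are answered.
  Both regimes thus have the aggregate value 1/2, and by the alternation the empirical mean over any
  even number of consecutive origins in the second regime is exactly 1/2, so the aggregate bound
  passes the threshold 1/4 by mere decay of the confidence radius, with no law of large numbers.
  The protected empirical mean in the second regime is always 0.
\<close>

section \<open>Regime values and confidence bounds\<close>

lemma p_regime_eqI:
  assumes "eligible M S R \<psi> \<noteq> {}" "\<And>n. n \<in> eligible M S R \<psi> \<Longrightarrow> resp_prob M S R \<psi> n = v"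
  shows "p_regime M S R \<psi> = v"
  unfolding p_regime_def using assms by (intro the_equality) auto

lemma p_core_regime_eqI:
  assumes "eligible M S R \<psi> \<noteq> {}" "\<And>n. n \<in> eligible M S R \<psi> \<Longrightarrow> core_resp_prob M S R \<psi> n = v"
  shows "p_core_regime M S R \<psi> = v"
  unfolding p_core_regime_def using assms by (intro the_equality) auto

text \<open>The inverse allocation grows only quadratically in \<open>q\<close>, so its logarithm is
  negligible against \<open>2 * q\<close>.\<close>

lemma confidence_radius_tendsto_0:
  assumes "0 < \<delta>"
  shows "(\<lambda>q. sqrt (ln (1 / alloc \<delta> q) / (2 * real q))) \<longlonglongrightarrow> 0"
proof -
  define c where "c = pi\<^sup>2 / (6 * \<delta>)"
  have "c > 0"
    using assms by (simp add: c_def)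
  then have "(\<lambda>q::nat. sqrt (ln (c * (real q)\<^sup>2) / (2 * real q))) \<longlonglongrightarrow> 0"
    by real_asymp
  then show ?thesis
    by (simp add: alloc_def c_def)
qed

text \<open>\<open>sqrt\<close> is odd, so a negative argument would lift the bound above 0. The
  estimate 6 \<delta> < 9 < pi^2 keeps the allocation below 1 and the radius nonnegative.\<close>

lemma lower_bound_eq_0:
  assumes "0 < \<delta>" "\<delta> < 1" "emp_mean \<psi> e K = 0"
  shows "lower_bound \<delta> \<psi> e K = 0"
proof (cases "card K = 0")
  case False
  have "6 * \<delta> \<le> 9 * 1"
    using assms by simp
  also have "\<dots> \<le> pi\<^sup>2 * (real (card K))\<^sup>2"
  proof (rule mult_mono)
    show "9 \<le> pi\<^sup>2"
      using power_mono[of 3 pi 2] pi_gt3 by simp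
    show "1 \<le> (real (card K))\<^sup>2"
      using False by (simp add: one_le_power Suc_le_eq)
  qed auto
  finally have "1 \<le> 1 / alloc \<delta> (card K)"
    using assms False by (simp add: alloc_def field_simps)
  then have "0 \<le> ln (1 / alloc \<delta> (card K)) / (2 * real (card K))"
    by (intro divide_nonneg_nonneg ln_ge_zero) auto
  then show ?thesis
    using assms by (simp add: lower_bound_def max_def)
qed (simp add: lower_bound_def)

lemma sum_parity_consecutive:
  "(\<Sum>k\<in>{n<..<n + 1 + 2 * j}. of_bool (even k \<longleftrightarrow> b)) = real j"
proof (induction j)
  case (Suc j)
  have "{n<..<n + 1 + 2 * Suc j} =
      insert (n + 1 + 2 * j) (insert (n + 2 + 2 * j) {n<..<n + 1 + 2 * j})"
    by auto
  then show ?case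
    \<comment> \<open>The sum must not turn into a cardinality, or the induction hypothesis would no
      longer match. Of the two new neighbours exactly one has the chosen parity.\<close>
    using Suc by (simp del: sum_of_bool_eq)
qed (auto simp: greaterThanLessThan_eq)

text \<open>
  Atom 0 marks protected origins and atom 1 a response.  The bit \<open>c\<close> says which parity is protected
  and \<open>x\<close> whether index 0 is answered.
\<close>

definition stream :: "bool \<Rightarrow> bool \<Rightarrow> nat tstream" where
  "stream c x n = (real n,
     {i. i = 0 \<and> (even n \<longleftrightarrow> c) \<or> i = 1 \<and> (if n = 0 then x else even n \<noteq> c)})"

text \<open>The trigger \<open>Top\<close> makes every index an origin. On streams with time n at
  index n, the window [0,0] inspects only the origin itself.\<close>

definition spec :: "nat tspec" where
  "spec = \<lparr>trig_core = Atom 0, trig_adapt = Top, resp_core = Atom 1, resp_adapt = Top,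
           threshold = 1/4, win_lo = 0, win_hi = 0\<rparr>"

text \<open>Index 0 is even, hence protected iff \<open>c\<close>. Answering it iff \<open>c\<close>
  equals \<open>y\<close> gives the chances 99/100 and 1/100, which average to 1/2.\<close>

definition law :: "nat tstream pmf" where
  "law = map_pmf (\<lambda>(c, y). stream c (c \<longleftrightarrow> y))
     (pair_pmf (bernoulli_pmf (1/2)) (bernoulli_pmf (99/100)))"

text \<open>The law lives on the type of all sequences, so the random stream is made a timed stream at the
  null points, too, by rebuilding it from the label at index 0.\<close>

definition rebuild :: "nat tstream \<Rightarrow> nat tstream" where
  "rebuild \<omega> = stream (0 \<in> label \<omega> 0) (1 \<in> label \<omega> 0)"

lemma rebuild_stream [simp]: "rebuild (stream c x) = stream c x"
  by (simp add: rebuild_def stream_def)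

lemma time_stream [simp]: "time (stream c x) n = real n"
  by (simp add: stream_def)

lemma label_stream [simp]:
  "0 \<in> label (stream c x) n \<longleftrightarrow> (even n \<longleftrightarrow> c)"
  "Suc 0 \<in> label (stream c x) n \<longleftrightarrow> (if n = 0 then x else even n \<noteq> c)"
  by (simp_all add: stream_def)

lemma timed_stream_stream: "timed_stream {0, 1} (stream c x)"
  unfolding timed_stream_def
  by (auto simp: stream_def filterlim_real_sequentially)

lemma spec_simps [simp]:
  "horizon spec = 0" "threshold spec = 1/4"
  "sat e (trig spec) n" "sat e (trig_core spec) n \<longleftrightarrow> 0 \<in> label e n"
  "sat e (adapt_only spec) n \<longleftrightarrow> 0 \<notin> label e n"
  by (simp_all add: spec_def horizon_def trig_def resp_def adapt_only_def)

lemma responded_stream [simp]: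
  "responded spec (stream c x) n \<longleftrightarrow> (if n = 0 then x else even n \<noteq> c)"
  by (auto simp: responded_def spec_def resp_def)

text \<open>Reduces every probability to membership of four paths, which \<open>simp\<close> can
  decide.\<close>

lemma measure_law:
  "measure law A =
     (99 * of_bool (stream True True \<in> A) + of_bool (stream True False \<in> A) +
      99 * of_bool (stream False False \<in> A) + of_bool (stream False True \<in> A)) / 200"
proof -
  define Q where "Q = (\<lambda>(c, y). stream c (c \<longleftrightarrow> y)) -` A"
  have "measure law A = measure (pair_pmf (bernoulli_pmf (1/2)) (bernoulli_pmf (99/100))) Q"
    by (simp add: law_def Q_def)
  also have "\<dots> = (\<Sum>z\<in>UNIV. pmf (bernoulli_pmf (1/2)) (fst z) * pmf (bernoulli_pmf (99/100)) (snd z)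
      * of_bool (z \<in> Q))"
    by (subst measure_measure_pmf_finite, simp)
       (intro sum.mono_neutral_cong_left, auto simp: pmf_pair)
  also have "\<dots> = (99 * of_bool ((True, True) \<in> Q) + of_bool ((True, False) \<in> Q) +
      99 * of_bool ((False, True) \<in> Q) + of_bool ((False, False) \<in> Q)) / 200"
    by (simp add: UNIV_Times_UNIV[symmetric] sum.cartesian_product' UNIV_bool del: UNIV_Times_UNIV)
  finally show ?thesis
    by (simp add: Q_def)
qed

text \<open>Horizon 0 still demands a strictly later event in the regime. This leaves a single
  eligible index, so stability there is constancy on a singleton.\<close>

lemma completes_in_first [simp]: "completes_in {..<2} spec (stream c x) n \<longleftrightarrow> n = 0"
  by (auto simp: completes_in_def)

lemma completes_in_second [simp]: "2 \<le> n \<Longrightarrow> completes_in {2..} spec (stream c x) n"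
  by (auto simp: completes_in_def intro!: bexI[of _ "Suc n"])

section \<open>Eligibility and conditional probabilities\<close>

lemma eligible_first: "eligible law rebuild {..<2} spec = {0}"
proof -
  have "\<P>(\<omega> in law. sat (rebuild \<omega>) (trig spec) n \<and> completes_in {..<2} spec (rebuild \<omega>) n) =
      of_bool (n = 0)" for n
    by (simp add: measure_law)
  then show ?thesis
    by (auto simp: eligible_def)
qed

lemma eligible_second: "eligible law rebuild {2..} spec = {2..}"
proof -
  have "\<P>(\<omega> in law. sat (rebuild \<omega>) (trig spec) n \<and> completes_in {2..} spec (rebuild \<omega>) n) = 1"
    if "2 \<le> n" for n
    using that by (simp add: measure_law)
  then show ?thesis
    by (auto simp: eligible_def)
qed

lemmas regime_probs = resp_prob_def core_share_def core_resp_prob_def adapt_resp_prob_def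
  cond_prob_def measure_law

lemma probs_first:
  "resp_prob law rebuild {..<2} spec 0 = 1/2"
  "core_resp_prob law rebuild {..<2} spec 0 = 99/100"
  "0 < \<P>(\<omega> in law. sat (rebuild \<omega>) (trig_core spec) 0 \<and> completes_in {..<2} spec (rebuild \<omega>) 0)"
  "0 < \<P>(\<omega> in law. sat (rebuild \<omega>) (adapt_only spec) 0 \<and> completes_in {..<2} spec (rebuild \<omega>) 0)"
  by (simp_all add: regime_probs)

lemma probs_second:
  assumes "2 \<le> n"
  shows "resp_prob law rebuild {2..} spec n = 1/2"
    "core_share law rebuild {2..} spec n = 1/2"
    "core_resp_prob law rebuild {2..} spec n = 0"
    "adapt_resp_prob law rebuild {2..} spec n = 1"
    "0 < \<P>(\<omega> in law. sat (rebuild \<omega>) (trig_core spec) n \<and> completes_in {2..} spec (rebuild \<omega>) n)"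
    "0 < \<P>(\<omega> in law. sat (rebuild \<omega>) (adapt_only spec) n \<and> completes_in {2..} spec (rebuild \<omega>) n)"
  \<comment> \<open>The parity of \<open>n\<close> only decides which value of the fair bit protects
    it.\<close>
  using assms by (cases "even n"; simp add: regime_probs)+

lemma stable_first:
  "regime_stable law rebuild {..<2} spec" "within_group_stable law rebuild {..<2} spec"
  using probs_first(3,4) unfolding regime_stable_def within_group_stable_def eligible_first by auto

lemma stable_second:
  "regime_stable law rebuild {2..} spec" "within_group_stable law rebuild {2..} spec"
  unfolding regime_stable_def within_group_stable_def eligible_second
  by (intro conjI exI ballI; (rule probs_second)?; simp)+

section \<open>Certification along each path\<close>

lemma K_all_stream: "K_all spec (stream c x) nsel m = {nsel<..<m}"
  by (auto simp: K_all_def)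

lemma completed_origins_stream: "completed_origins spec (stream c x) nsel = {nsel<..}"
  by (auto simp: completed_origins_def K_all_stream intro!: bexI[of _ "Suc _"])

lemma governs_stream: "governs {2..} spec (stream c x) nsel \<longleftrightarrow> 1 \<le> nsel"
proof
  assume "governs {2..} spec (stream c x) nsel"
  then have "Suc nsel \<in> {2..}"
    unfolding governs_def completed_origins_stream by blast
  then show "1 \<le> nsel"
    by simp
qed (auto simp: governs_def completed_origins_stream infinite_Ioi)

lemma emp_mean_all_stream:
  assumes "0 < j"
  shows "emp_mean spec (stream c x) {nsel<..<nsel + 1 + 2 * j} = 1/2"
proof -
  have "(\<Sum>k\<in>{nsel<..<nsel + 1 + 2 * j}. resp_ind spec (stream c x) k) =
      (\<Sum>k\<in>{nsel<..<nsel + 1 + 2 * j}. of_bool (even k \<longleftrightarrow> \<not> c))"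
    \<comment> \<open>Origins beyond \<open>nsel\<close> are positive, which excludes the
      exceptional index 0.\<close>
    by (intro sum.cong) auto
  then show ?thesis
    using assms unfolding emp_mean_def sum_parity_consecutive by simp
qed

lemma aggregate_certifies_stream:
  assumes "0 < \<delta>"
  shows "\<exists>m>nsel. aggregate_certifies \<delta> spec (stream c x) nsel m"
proof -
  have "\<forall>\<^sub>F q in sequentially. sqrt (ln (1 / alloc \<delta> q) / (2 * real q)) < 1/4"
    by (intro order_tendstoD(2)[OF confidence_radius_tendsto_0[OF assms]]) simp
  then obtain q0 where q0: "\<And>q. q0 \<le> q \<Longrightarrow> sqrt (ln (1 / alloc \<delta> q) / (2 * real q)) < 1/4"
    unfolding eventually_sequentially by blast
  \<comment> \<open>The sample size 2j is even, positive and at least \<open>q0\<close>; the radius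
    then fits into the slack 1/2 - 1/4.\<close>
  define j where "j = Suc q0"
  have card: "card {nsel<..<nsel + 1 + 2 * j} = 2 * j"
    by simp
  have "sqrt (ln (1 / alloc \<delta> (2 * j)) / (2 * real (2 * j))) < 1/4"
    by (rule q0) (simp add: j_def)
  moreover have "emp_mean spec (stream c x) {nsel<..<nsel + 1 + 2 * j} = 1/2"
    by (rule emp_mean_all_stream) (simp add: j_def)
  ultimately have "aggregate_certifies \<delta> spec (stream c x) nsel (nsel + 1 + 2 * j)"
    unfolding aggregate_certifies_def K_all_stream lower_bound_def card
    by (simp add: j_def)
  then show ?thesis
    by (intro exI[of _ "nsel + 1 + 2 * j"]) simp
qed

lemma lower_bound_core_stream:
  assumes "0 < \<delta>" "\<delta> < 1"
  shows "lower_bound \<delta> spec (stream c x) (K_core spec (stream c x) nsel m) = 0"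
proof (rule lower_bound_eq_0[OF assms])
  have "resp_ind spec (stream c x) k = 0" if "k \<in> K_core spec (stream c x) nsel m" for k
    using that by (auto simp: K_core_def K_all_stream)
  then show "emp_mean spec (stream c x) (K_core spec (stream c x) nsel m) = 0"
    by (simp add: emp_mean_def)
qed

lemma random_timed_stream_rebuild: "random_timed_stream {0, 1} law rebuild"
  unfolding random_timed_stream_def
proof (intro conjI ballI)
  show "prob_space law"
    by (rule prob_space_measure_pmf)
  \<comment> \<open>Every set is measurable for a pmf, so only the range of \<open>rebuild\<close>
    matters.\<close>
  show "rebuild \<in> law \<rightarrow>\<^sub>M (\<Pi>\<^sub>M n\<in>UNIV. borel \<Otimes>\<^sub>M count_space (Pow {0, 1}))"
    by (auto simp: space_PiM space_pair_measure rebuild_def stream_def)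
  show "timed_stream {0, 1} (rebuild \<omega>)" for \<omega>
    unfolding rebuild_def by (rule timed_stream_stream)
qed

lemma regime_sequence_two: "regime_sequence 2 (\<lambda>r. if r = 0 then {..<2} else {2..})"
proof -
  have first: "{..<2} = {0, 1 :: nat}"
    by auto
  have "r = 0" if "enat (Suc r) < 2" for r
    using that by (cases r) (simp_all add: numeral_eq_enat)
  then show ?thesis
    by (auto simp: regime_sequence_def first)
qed

theorem proposition1:
  shows "\<exists>(AP :: nat set) (Env :: (real \<times> real \<times> real) set) (\<psi> :: nat tspec) (core_thr :: real)
           (M :: nat tstream measure) (S :: nat tstream \<Rightarrow> nat tstream)
           (N :: enat) (Rs :: nat \<Rightarrow> nat set).
      finite AP \<and>
      valid_spec AP Env \<psi> \<and> trig_core \<psi> \<noteq> Bot \<and>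
      0 \<le> core_thr \<and> core_thr \<le> 1 \<and>
      random_timed_stream AP M S \<and>
      regime_sequence N Rs \<and> enat 1 < N \<and>
      (\<forall>r\<in>{0, 1}. regime_stable M S (Rs r) \<psi> \<and> within_group_stable M S (Rs r) \<psi>) \<and>
      p_regime M S (Rs 0) \<psi> = p_regime M S (Rs 1) \<psi> \<and>
      p_core_regime M S (Rs 0) \<psi> = 0.99 \<and>
      p_core_regime M S (Rs 1) \<psi> = 0 \<and>
      (\<exists>nsel. AE \<omega> in M. governs (Rs 1) \<psi> (S \<omega>) nsel) \<and>
      (AE \<omega> in M. \<forall>nsel \<delta>all \<delta>core.
         valid_allocs \<delta>all \<delta>core \<longrightarrow> governs (Rs 1) \<psi> (S \<omega>) nsel \<longrightarrow>
         (\<exists>m>nsel. aggregate_certifies \<delta>all \<psi> (S \<omega>) nsel m)) \<and>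
      (\<forall>\<omega>\<in>space M. \<forall>nsel \<delta>all \<delta>core.
         valid_allocs \<delta>all \<delta>core \<longrightarrow> governs (Rs 1) \<psi> (S \<omega>) nsel \<longrightarrow>
         \<not> (\<exists>m>nsel. joint_certifies \<delta>all \<delta>core core_thr \<psi> (S \<omega>) nsel m))"
proof (intro exI conjI)
  let ?Rs = "\<lambda>r::nat. if r = 0 then {..<2::nat} else {2::nat..}"
  show "finite {0, 1 :: nat}"
    by simp
  show "valid_spec {0, 1} {(1/4, 0, 0)} spec" "trig_core spec \<noteq> Bot"
    by (simp_all add: valid_spec_def spec_def)
  \<comment> \<open>Any positive core threshold would do, since the protected bound is always
    0.\<close>
  show "0 \<le> (1/2 :: real)" "1/2 \<le> (1 :: real)"
    by simp_all
  show "random_timed_stream {0, 1} law rebuild"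
    by (rule random_timed_stream_rebuild)
  show "regime_sequence 2 ?Rs"
    by (rule regime_sequence_two)
  show "enat 1 < 2"
    by (simp add: numeral_eq_enat)
  show "\<forall>r\<in>{0, 1}. regime_stable law rebuild (?Rs r) spec \<and>
      within_group_stable law rebuild (?Rs r) spec"
    using stable_first stable_second by simp
  have "p_regime law rebuild {..<2} spec = 1/2" "p_regime law rebuild {2..} spec = 1/2"
    by (rule p_regime_eqI; auto simp: eligible_first eligible_second probs_first probs_second)+
  then show "p_regime law rebuild (?Rs 0) spec = p_regime law rebuild (?Rs 1) spec"
    by simp
  have "p_core_regime law rebuild {..<2} spec = 0.99" "p_core_regime law rebuild {2..} spec = 0"
    by (rule p_core_regime_eqI; auto simp: eligible_first eligible_second probs_first probs_second)+
  then show "p_core_regime law rebuild (?Rs 0) spec = 0.99" "p_core_regime law rebuild (?Rs 1) spec = 0"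
    by simp_all
  \<comment> \<open>Index 1 ends the first regime, so all later origins lie in the second and the
    governing hypothesis is not vacuous.\<close>
  show "AE \<omega> in law. governs (?Rs 1) spec (rebuild \<omega>) 1"
    by (simp add: rebuild_def governs_stream)
  show "AE \<omega> in law. \<forall>nsel \<delta>all \<delta>core. valid_allocs \<delta>all \<delta>core \<longrightarrow>
      governs (?Rs 1) spec (rebuild \<omega>) nsel \<longrightarrow>
      (\<exists>m>nsel. aggregate_certifies \<delta>all spec (rebuild \<omega>) nsel m)"
    by (simp add: rebuild_def aggregate_certifies_stream valid_allocs_def)
  show "\<forall>\<omega>\<in>space law. \<forall>nsel \<delta>all \<delta>core. valid_allocs \<delta>all \<delta>core \<longrightarrow>
      governs (?Rs 1) spec (rebuild \<omega>) nsel \<longrightarrow>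
      \<not> (\<exists>m>nsel. joint_certifies \<delta>all \<delta>core (1/2) spec (rebuild \<omega>) nsel m)"
    by (simp add: rebuild_def joint_certifies_def lower_bound_core_stream valid_allocs_def)
qed

end
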